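(* Let $K$ be a field. If $(C_1,C_0,s,t,e,k,\tau)$ is a braided categorical associative $K$-algebra, then $(C_1^{\mathcal L},C_0^{\mathcal L},s,t,e,k,\tau^{Lie})$ is a braided categorical Lie $K$-algebra, where \[\tau^{Lie}\colon C_0^{\mathcal L}\times C_0^{\mathcal L}\to C_1^{\mathcal L},\qquad \tau^{Lie}_{a,b}:=\tau_{a,b}-\tau_{b,a}.\]
   Context: Associative $K$-algebras are not necessarily unital; homomorphisms are $K$-linear multiplicative maps. For an associative $K$-algebra $A$, $A^{\mathcal L}$ denotes the Lie $K$-algebra on the same vector space with bracket $[a,a']=aa'-a'a$. A categorical associative (resp. Lie) $K$-algebra is an internal category in the category of associative (resp. Lie) $K$-algebras: algebras $C_1,C_0$ of that type and homomorphisms $s,t\colon C_1\to C_0$, $e\colon C_0\to C_1$, $k\colon C_1\times_{C_0}C_1\to C_1$, with $C_1\times_{C_0}C_1=\{(x,y): t(x)=s(y)\}$, satisfying $se=te=\mathrm{Id}$, $s(k(x,y))=s(x)$, $t(k(x,y))=t(y)$, $k(e(s(x)),x)=x=k(x,e(t(x)))$, and associativity of $k$. Write $y\circ x=k((x,y))$, and $x\colon a\to b$ when $s(x)=a$, $t(x)=b$. A braided categorical associative $K$-algebra is a categorical associative $K$-algebra with a $K$-bilinear map $\tau\colon C_0\times C_0\to C_1$, $(a,b)\mapsto\tau_{a,b}$, such that for $a,b,c\in C_0$, $x,y\in C_1$: $\tau_{a,b}\colon ab\to ba$; $\tau_{t(x),t(y)}\circ(xy)=(yx)\circ\tau_{s(x),s(y)}$;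 $\tau_{ab,c}=(\tau_{a,c}e(b))\circ(e(a)\tau_{b,c})$; $\tau_{a,bc}=(e(b)\tau_{a,c})\circ(\tau_{a,b}e(c))$. A braided categorical Lie $K$-algebra is a categorical Lie $K$-algebra with a $K$-bilinear map $\tau\colon C_0\times C_0\to C_1$ such that for $a,b,c\in C_0$, $x,y\in C_1$: $\tau_{a,b}\colon[a,b]\to[b,a]$; $\tau_{t(x),t(y)}\circ[x,y]=[y,x]\circ\tau_{s(x),s(y)}$; $\tau_{[a,b],c}=[\tau_{a,c},e(b)]+[e(a),\tau_{b,c}]$; $\tau_{a,[b,c]}=[e(b),\tau_{a,c}]+[\tau_{a,b},e(c)]$. *)

theory Defs
  imports "HOL-Algebra.Module"
begin

text \<open>
  Algebras are module records: the field \<open>mult\<close> is the product of an associative algebra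
  or the bracket of a Lie algebra. The field \<open>one\<close> of the record is ignored, since algebras are not
  assumed to be unital. The locale \<open>algebra\<close> of HOL-Algebra is not suitable here, as it
  requires a commutative unital product.
\<close>

definition linear_map ::
  "('k, 'm) ring_scheme \<Rightarrow> ('k, 'a, 'p) module_scheme \<Rightarrow> ('k, 'b, 'q) module_scheme \<Rightarrow> ('a \<Rightarrow> 'b) set"
  where "linear_map K V W = {f \<in> carrier V \<rightarrow> carrier W.
    (\<forall>x\<in>carrier V. \<forall>y\<in>carrier V. f (x \<oplus>\<^bsub>V\<^esub> y) = f x \<oplus>\<^bsub>W\<^esub> f y) \<and>
    (\<forall>r\<in>carrier K. \<forall>x\<in>carrier V. f (r \<odot>\<^bsub>V\<^esub> x) = r \<odot>\<^bsub>W\<^esub> f x)}"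

definition bilinear_map ::
  "('k, 'm) ring_scheme \<Rightarrow> ('k, 'a, 'p) module_scheme \<Rightarrow> ('k, 'b, 'q) module_scheme \<Rightarrow>
    ('k, 'c, 'r) module_scheme \<Rightarrow> ('a \<Rightarrow> 'b \<Rightarrow> 'c) set"
  where "bilinear_map K U V W = {f.
    (\<forall>u\<in>carrier U. (\<lambda>v. f u v) \<in> linear_map K V W) \<and>
    (\<forall>v\<in>carrier V. (\<lambda>u. f u v) \<in> linear_map K U W)}"

definition algebra_hom ::
  "('k, 'm) ring_scheme \<Rightarrow> ('k, 'a, 'p) module_scheme \<Rightarrow> ('k, 'b, 'q) module_scheme \<Rightarrow> ('a \<Rightarrow> 'b) set"
  where "algebra_hom K A B = {f \<in> linear_map K A B.
    \<forall>x\<in>carrier A. \<forall>y\<in>carrier A. f (x \<otimes>\<^bsub>A\<^esub> y) = f x \<otimes>\<^bsub>B\<^esub> f y}"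

locale assoc_algebra = module K A for K (structure) and A (structure) +
  assumes mult_bilinear: "(\<otimes>\<^bsub>A\<^esub>) \<in> bilinear_map K A A A"
    and mult_assoc: "\<lbrakk>x \<in> carrier A; y \<in> carrier A; z \<in> carrier A\<rbrakk> \<Longrightarrow>
      (x \<otimes>\<^bsub>A\<^esub> y) \<otimes>\<^bsub>A\<^esub> z = x \<otimes>\<^bsub>A\<^esub> (y \<otimes>\<^bsub>A\<^esub> z)"

locale lie_algebra = module K L for K (structure) and L (structure) +
  assumes bracket_bilinear: "(\<otimes>\<^bsub>L\<^esub>) \<in> bilinear_map K L L L"
    and bracket_alternating: "x \<in> carrier L \<Longrightarrow> x \<otimes>\<^bsub>L\<^esub> x = \<zero>\<^bsub>L\<^esub>"
    and jacobi: "\<lbrakk>x \<in> carrier L; y \<in> carrier L; z \<in> carrier L\<rbrakk> \<Longrightarrow>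
      x \<otimes>\<^bsub>L\<^esub> (y \<otimes>\<^bsub>L\<^esub> z) \<oplus>\<^bsub>L\<^esub> y \<otimes>\<^bsub>L\<^esub> (z \<otimes>\<^bsub>L\<^esub> x) \<oplus>\<^bsub>L\<^esub> z \<otimes>\<^bsub>L\<^esub> (x \<otimes>\<^bsub>L\<^esub> y) = \<zero>\<^bsub>L\<^esub>"

definition lie_of :: "('k, 'a, 'p) module_scheme \<Rightarrow> ('k, 'a, 'p) module_scheme"
  where "lie_of A = A\<lparr>mult := \<lambda>x y. x \<otimes>\<^bsub>A\<^esub> y \<ominus>\<^bsub>A\<^esub> y \<otimes>\<^bsub>A\<^esub> x\<rparr>"

text \<open>
  The algebra of composable pairs \<open>C1 \<times>\<^bsub>C0\<^esub> C1\<close>. Only the carrier depends on \<open>s\<close> and \<open>t\<close>; the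
  operations are componentwise.
\<close>

definition composable_pairs ::
  "('k, 'a, 'p) module_scheme \<Rightarrow> ('a \<Rightarrow> 'b) \<Rightarrow> ('a \<Rightarrow> 'b) \<Rightarrow> ('k, 'a \<times> 'a) module"
  where "composable_pairs C1 s t =
    \<lparr>carrier = {(x, y). x \<in> carrier C1 \<and> y \<in> carrier C1 \<and> t x = s y},
     mult = \<lambda>(x, y) (x', y'). (x \<otimes>\<^bsub>C1\<^esub> x', y \<otimes>\<^bsub>C1\<^esub> y'),
     one = (\<one>\<^bsub>C1\<^esub>, \<one>\<^bsub>C1\<^esub>),
     zero = (\<zero>\<^bsub>C1\<^esub>, \<zero>\<^bsub>C1\<^esub>),
     add = \<lambda>(x, y) (x', y'). (x \<oplus>\<^bsub>C1\<^esub> x', y \<oplus>\<^bsub>C1\<^esub> y'),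
     smult = \<lambda>r (x, y). (r \<odot>\<^bsub>C1\<^esub> x, r \<odot>\<^bsub>C1\<^esub> y)\<rparr>"

text \<open>
  The internal category data shared by the associative and the Lie case: in both, a morphism is a
  linear map compatible with \<open>mult\<close>.
\<close>

locale internal_category =
  fixes K :: "('k, 'm) ring_scheme"
    and C1 :: "('k, 'a, 'p) module_scheme"
    and C0 :: "('k, 'b, 'q) module_scheme"
    and s t :: "'a \<Rightarrow> 'b"
    and e :: "'b \<Rightarrow> 'a"
    and k :: "'a \<times> 'a \<Rightarrow> 'a"
  assumes s_hom: "s \<in> algebra_hom K C1 C0"
    and t_hom: "t \<in> algebra_hom K C1 C0"
    and e_hom: "e \<in> algebra_hom K C0 C1"
    and k_hom: "k \<in> algebra_hom K (composable_pairs C1 s t) C1"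
    and s_e: "a \<in> carrier C0 \<Longrightarrow> s (e a) = a"
    and t_e: "a \<in> carrier C0 \<Longrightarrow> t (e a) = a"
    and s_k: "\<lbrakk>x \<in> carrier C1; y \<in> carrier C1; t x = s y\<rbrakk> \<Longrightarrow> s (k (x, y)) = s x"
    and t_k: "\<lbrakk>x \<in> carrier C1; y \<in> carrier C1; t x = s y\<rbrakk> \<Longrightarrow> t (k (x, y)) = t y"
    and k_unit_source: "x \<in> carrier C1 \<Longrightarrow> k (e (s x), x) = x"
    and k_unit_target: "x \<in> carrier C1 \<Longrightarrow> k (x, e (t x)) = x"
    and k_assoc: "\<lbrakk>x \<in> carrier C1; y \<in> carrier C1; z \<in> carrier C1; t x = s y; t y = s z\<rbrakk> \<Longrightarrow>
      k (k (x, y), z) = k (x, k (y, z))"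
begin

abbreviation composite :: "'a \<Rightarrow> 'a \<Rightarrow> 'a"  (infixr \<open>\<cdot>\<close> 55)
  where "y \<cdot> x \<equiv> k (x, y)"

end

locale categorical_assoc_algebra = internal_category K C1 C0 s t e k
  for K C1 C0 s t e k +
  assumes C1_assoc: "assoc_algebra K C1"
    and C0_assoc: "assoc_algebra K C0"

locale categorical_lie_algebra = internal_category K C1 C0 s t e k
  for K C1 C0 s t e k +
  assumes C1_lie: "lie_algebra K C1"
    and C0_lie: "lie_algebra K C0"

locale braided_categorical_assoc_algebra = categorical_assoc_algebra K C1 C0 s t e k
  for K :: "('k, 'm) ring_scheme"
    and C1 :: "('k, 'a, 'p) module_scheme"
    and C0 :: "('k, 'b, 'q) module_scheme"
    and s t e k +
  fixes \<tau> :: "'b \<Rightarrow> 'b \<Rightarrow> 'a"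
  assumes \<tau>_bilinear: "\<tau> \<in> bilinear_map K C0 C0 C1"
    and s_\<tau>: "\<lbrakk>a \<in> carrier C0; b \<in> carrier C0\<rbrakk> \<Longrightarrow> s (\<tau> a b) = a \<otimes>\<^bsub>C0\<^esub> b"
    and t_\<tau>: "\<lbrakk>a \<in> carrier C0; b \<in> carrier C0\<rbrakk> \<Longrightarrow> t (\<tau> a b) = b \<otimes>\<^bsub>C0\<^esub> a"
    and \<tau>_natural: "\<lbrakk>x \<in> carrier C1; y \<in> carrier C1\<rbrakk> \<Longrightarrow>
      \<tau> (t x) (t y) \<cdot> (x \<otimes>\<^bsub>C1\<^esub> y) = (y \<otimes>\<^bsub>C1\<^esub> x) \<cdot> \<tau> (s x) (s y)"
    and \<tau>_mult_left: "\<lbrakk>a \<in> carrier C0; b \<in> carrier C0; c \<in> carrier C0\<rbrakk> \<Longrightarrow>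
      \<tau> (a \<otimes>\<^bsub>C0\<^esub> b) c = (\<tau> a c \<otimes>\<^bsub>C1\<^esub> e b) \<cdot> (e a \<otimes>\<^bsub>C1\<^esub> \<tau> b c)"
    and \<tau>_mult_right: "\<lbrakk>a \<in> carrier C0; b \<in> carrier C0; c \<in> carrier C0\<rbrakk> \<Longrightarrow>
      \<tau> a (b \<otimes>\<^bsub>C0\<^esub> c) = (e b \<otimes>\<^bsub>C1\<^esub> \<tau> a c) \<cdot> (\<tau> a b \<otimes>\<^bsub>C1\<^esub> e c)"

locale braided_categorical_lie_algebra = categorical_lie_algebra K C1 C0 s t e k
  for K :: "('k, 'm) ring_scheme"
    and C1 :: "('k, 'a, 'p) module_scheme"
    and C0 :: "('k, 'b, 'q) module_scheme"
    and s t e k +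
  fixes \<tau> :: "'b \<Rightarrow> 'b \<Rightarrow> 'a"
  assumes \<tau>_bilinear: "\<tau> \<in> bilinear_map K C0 C0 C1"
    and s_\<tau>: "\<lbrakk>a \<in> carrier C0; b \<in> carrier C0\<rbrakk> \<Longrightarrow> s (\<tau> a b) = a \<otimes>\<^bsub>C0\<^esub> b"
    and t_\<tau>: "\<lbrakk>a \<in> carrier C0; b \<in> carrier C0\<rbrakk> \<Longrightarrow> t (\<tau> a b) = b \<otimes>\<^bsub>C0\<^esub> a"
    and \<tau>_natural: "\<lbrakk>x \<in> carrier C1; y \<in> carrier C1\<rbrakk> \<Longrightarrow>
      \<tau> (t x) (t y) \<cdot> (x \<otimes>\<^bsub>C1\<^esub> y) = (y \<otimes>\<^bsub>C1\<^esub> x) \<cdot> \<tau> (s x) (s y)"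
    and \<tau>_bracket_left: "\<lbrakk>a \<in> carrier C0; b \<in> carrier C0; c \<in> carrier C0\<rbrakk> \<Longrightarrow>
      \<tau> (a \<otimes>\<^bsub>C0\<^esub> b) c = \<tau> a c \<otimes>\<^bsub>C1\<^esub> e b \<oplus>\<^bsub>C1\<^esub> e a \<otimes>\<^bsub>C1\<^esub> \<tau> b c"
    and \<tau>_bracket_right: "\<lbrakk>a \<in> carrier C0; b \<in> carrier C0; c \<in> carrier C0\<rbrakk> \<Longrightarrow>
      \<tau> a (b \<otimes>\<^bsub>C0\<^esub> c) = e b \<otimes>\<^bsub>C1\<^esub> \<tau> a c \<oplus>\<^bsub>C1\<^esub> \<tau> a b \<otimes>\<^bsub>C1\<^esub> e c"

definition lie_braiding ::
  "('k, 'a, 'p) module_scheme \<Rightarrow> ('b \<Rightarrow> 'b \<Rightarrow> 'a) \<Rightarrow> 'b \<Rightarrow> 'b \<Rightarrow> 'a"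
  where "lie_braiding C1 \<tau> a b = \<tau> a b \<ominus>\<^bsub>C1\<^esub> \<tau> b a"

end

theory Submission
  imports Defs
begin

text \<open>
  Linearity of the composition together with the unit laws forces \<open>k (x, y) = x + y - e (t x)\<close>.
  Substituting this into the two hexagon identities of \<open>\<tau>\<close> makes them additive up to an identity
  morphism, and in the antisymmetrization \<open>\<tau> a b - \<tau> b a\<close> these identity morphisms cancel.
\<close>

section \<open>Linear maps, bilinear maps and differences in abelian groups\<close>

lemma linear_mapD:
  assumes "f \<in> linear_map K V W" "x \<in> carrier V"
  shows "f x \<in> carrier W"
    and "y \<in> carrier V \<Longrightarrow> f (x \<oplus>\<^bsub>V\<^esub> y) = f x \<oplus>\<^bsub>W\<^esub> f y"
    and "r \<in> carrier K \<Longrightarrow> f (r \<odot>\<^bsub>V\<^esub> x) = r \<odot>\<^bsub>W\<^esub> f x"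
  using assms by (auto simp: linear_map_def)

lemma bilinear_mapD:
  assumes "f \<in> bilinear_map K U V W"
  shows "u \<in> carrier U \<Longrightarrow> f u \<in> linear_map K V W"
    and "v \<in> carrier V \<Longrightarrow> (\<lambda>u. f u v) \<in> linear_map K U W"
  using assms by (auto simp: bilinear_map_def)

lemma algebra_homD:
  assumes "f \<in> algebra_hom K A B"
  shows "f \<in> linear_map K A B"
    and "x \<in> carrier A \<Longrightarrow> y \<in> carrier A \<Longrightarrow> f (x \<otimes>\<^bsub>A\<^esub> y) = f x \<otimes>\<^bsub>B\<^esub> f y"
  using assms by (auto simp: algebra_hom_def)

context abelian_group
begin

text \<open>As rewrite rules these collect nested sums and differences into a single difference of
  two sums. \<open>diff_eq_iff\<close> then clears the subtraction, and what is left is settled by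
  commutativity.\<close>

lemma diff_simps:
  shows "\<lbrakk>a \<in> carrier G; b \<in> carrier G; c \<in> carrier G\<rbrakk> \<Longrightarrow> a \<oplus> (b \<ominus> c) = (a \<oplus> b) \<ominus> c"
    and "\<lbrakk>a \<in> carrier G; b \<in> carrier G; c \<in> carrier G\<rbrakk> \<Longrightarrow> (a \<ominus> b) \<oplus> c = (a \<oplus> c) \<ominus> b"
    and "\<lbrakk>a \<in> carrier G; b \<in> carrier G; c \<in> carrier G\<rbrakk> \<Longrightarrow> a \<ominus> (b \<ominus> c) = (a \<oplus> c) \<ominus> b"
    and "\<lbrakk>a \<in> carrier G; b \<in> carrier G; c \<in> carrier G\<rbrakk> \<Longrightarrow> (a \<ominus> b) \<ominus> c = a \<ominus> (b \<oplus> c)"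
  by (simp_all add: minus_eq minus_add a_ac)

lemma eq_minus_if_add_eq:
  "\<lbrakk>a \<in> carrier G; b \<in> carrier G; a \<oplus> b = c\<rbrakk> \<Longrightarrow> a = c \<ominus> b"
  by (auto simp: minus_eq a_assoc r_neg)

lemma diff_eq_iff:
  assumes "a \<in> carrier G" "b \<in> carrier G" "c \<in> carrier G"
  shows "a \<ominus> b = c \<longleftrightarrow> a = c \<oplus> b" "c = a \<ominus> b \<longleftrightarrow> c \<oplus> b = a"
  using assms by (auto simp: minus_eq a_assoc l_neg r_neg)

lemma minus_add_cancel: "\<lbrakk>a \<in> carrier G; b \<in> carrier G\<rbrakk> \<Longrightarrow> (a \<ominus> b) \<oplus> b = a"
  by (simp add: minus_eq a_assoc l_neg)

end

text \<open>Additivity at \<open>x\<close> minus \<open>y\<close> and \<open>y\<close> shows that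
  the left-hand side plus \<open>f y\<close> is \<open>f x\<close>; \<open>f y\<close> is then moved
  across.\<close>

lemma linear_map_minus:
  assumes "abelian_group V" "abelian_group W" "f \<in> linear_map K V W" "x \<in> carrier V" "y \<in> carrier V"
  shows "f (x \<ominus>\<^bsub>V\<^esub> y) = f x \<ominus>\<^bsub>W\<^esub> f y"
proof -
  interpret V: abelian_group V by fact
  interpret W: abelian_group W by fact
  note f = linear_mapD[OF assms(3)]
  show ?thesis
    using assms(4,5) by (intro W.eq_minus_if_add_eq) (simp_all add: f V.minus_add_cancel flip: f(2))
qed

lemma linear_map_diff:
  assumes "module K W" "f \<in> linear_map K V W" "g \<in> linear_map K V W"
  shows "(\<lambda>x. f x \<ominus>\<^bsub>W\<^esub> g x) \<in> linear_map K V W"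
proof -
  interpret module K W by fact
  note f = linear_mapD[OF assms(2)] and g = linear_mapD[OF assms(3)]
  show ?thesis
    unfolding linear_map_def
    by (auto simp: f g M.diff_simps M.a_ac)
       (simp_all add: f g M.minus_eq smult_r_distr smult_r_minus)
qed

text \<open>Serves twice: for the product it yields bilinearity of the commutator bracket, for
  \<open>\<tau>\<close> that of \<open>lie_braiding\<close>.\<close>

lemma bilinear_map_antisymmetrize:
  assumes "module K W" "f \<in> bilinear_map K V V W"
  shows "(\<lambda>u v. f u v \<ominus>\<^bsub>W\<^esub> f v u) \<in> bilinear_map K V V W"
  unfolding bilinear_map_def
  by (auto intro!: linear_map_diff assms(1) intro: bilinear_mapD[OF assms(2)])

section \<open>The commutator Lie algebra of an associative algebra\<close>

lemma lie_of_simps [simp]: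
  "carrier (lie_of A) = carrier A"
  "zero (lie_of A) = zero A"
  "add (lie_of A) = add A"
  "smult (lie_of A) = smult A"
  "mult (lie_of A) = (\<lambda>x y. x \<otimes>\<^bsub>A\<^esub> y \<ominus>\<^bsub>A\<^esub> y \<otimes>\<^bsub>A\<^esub> x)"
  by (simp_all add: lie_of_def)

text \<open>Subtraction is built from \<open>carrier\<close>, \<open>zero\<close> and
  \<open>add\<close> alone, and \<open>lie_of\<close> changes only \<open>mult\<close>.\<close>

lemma a_minus_lie_of [simp]: "a_minus (lie_of A) = a_minus A"
  by (simp add: a_minus_def a_inv_def lie_of_def fun_eq_iff)

lemma linear_map_lie_of [simp]:
  "linear_map K (lie_of V) W = linear_map K V W"
  "linear_map K V (lie_of W) = linear_map K V W"
  by (simp_all add: linear_map_def)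

lemma bilinear_map_lie_of [simp]:
  "bilinear_map K (lie_of U) (lie_of V) (lie_of W) = bilinear_map K U V W"
  by (simp add: bilinear_map_def)

lemma module_lie_of:
  assumes "module K A"
  shows "module K (lie_of A)"
proof -
  interpret module K A by fact
  interpret L: abelian_group "lie_of A"
    by (rule abelian_groupI) (auto simp: M.a_ac intro!: bexI[where x="\<ominus>\<^bsub>A\<^esub> x" for x] M.l_neg)
  show ?thesis
    by unfold_locales (simp_all add: smult_l_distr smult_r_distr smult_assoc1)
qed

text \<open>A linear multiplicative map sends a commutator to the commutator of the images.\<close>

lemma algebra_hom_lie_of:
  assumes "assoc_algebra K A" "assoc_algebra K B" "f \<in> algebra_hom K A B"
  shows "f \<in> algebra_hom K (lie_of A) (lie_of B)"
proof -
  interpret A: assoc_algebra K A by fact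
  interpret B: assoc_algebra K B by fact
  note f = algebra_homD[OF assms(3)]
  have "x \<otimes>\<^bsub>A\<^esub> y \<in> carrier A" if "x \<in> carrier A" "y \<in> carrier A" for x y
    using that A.mult_bilinear by (blast dest: bilinear_mapD linear_mapD)
  then show ?thesis
    using f linear_map_minus[OF A.M.abelian_group_axioms B.M.abelian_group_axioms f(1)]
    by (simp add: algebra_hom_def)
qed

context assoc_algebra
begin

lemmas mult_linear = bilinear_mapD[OF mult_bilinear]

lemma mult_closed [simp, intro]:
  "\<lbrakk>x \<in> carrier A; y \<in> carrier A\<rbrakk> \<Longrightarrow> x \<otimes>\<^bsub>A\<^esub> y \<in> carrier A"
  by (rule linear_mapD[OF mult_linear(1)])

lemma mult_minus_right:
  "\<lbrakk>x \<in> carrier A; y \<in> carrier A; z \<in> carrier A\<rbrakk> \<Longrightarrow>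
    x \<otimes>\<^bsub>A\<^esub> (y \<ominus>\<^bsub>A\<^esub> z) = x \<otimes>\<^bsub>A\<^esub> y \<ominus>\<^bsub>A\<^esub> x \<otimes>\<^bsub>A\<^esub> z"
  by (rule linear_map_minus[OF M.abelian_group_axioms M.abelian_group_axioms mult_linear(1)])

lemma mult_minus_left:
  "\<lbrakk>x \<in> carrier A; y \<in> carrier A; z \<in> carrier A\<rbrakk> \<Longrightarrow>
    (y \<ominus>\<^bsub>A\<^esub> z) \<otimes>\<^bsub>A\<^esub> x = y \<otimes>\<^bsub>A\<^esub> x \<ominus>\<^bsub>A\<^esub> z \<otimes>\<^bsub>A\<^esub> x"
  by (rule linear_map_minus[OF M.abelian_group_axioms M.abelian_group_axioms mult_linear(2)])

lemma lie_algebra_lie_of: "lie_algebra K (lie_of A)"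
proof -
  interpret L: module K "lie_of A"
    by (rule module_lie_of) (rule module_axioms)
  show ?thesis
  proof
    show "(\<otimes>\<^bsub>lie_of A\<^esub>) \<in> bilinear_map K (lie_of A) (lie_of A) (lie_of A)"
      using bilinear_map_antisymmetrize[OF module_axioms mult_bilinear]
      by simp
  next
    fix x assume "x \<in> carrier (lie_of A)"
    then show "x \<otimes>\<^bsub>lie_of A\<^esub> x = \<zero>\<^bsub>lie_of A\<^esub>"
      by (simp add: M.minus_eq M.r_neg)
  next
    fix x y z assume "x \<in> carrier (lie_of A)" "y \<in> carrier (lie_of A)" "z \<in> carrier (lie_of A)"
    then show "x \<otimes>\<^bsub>lie_of A\<^esub> (y \<otimes>\<^bsub>lie_of A\<^esub> z) \<oplus>\<^bsub>lie_of A\<^esub>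
        y \<otimes>\<^bsub>lie_of A\<^esub> (z \<otimes>\<^bsub>lie_of A\<^esub> x) \<oplus>\<^bsub>lie_of A\<^esub>
        z \<otimes>\<^bsub>lie_of A\<^esub> (x \<otimes>\<^bsub>lie_of A\<^esub> y) = \<zero>\<^bsub>lie_of A\<^esub>"
      \<comment> \<open>Expanding gives twelve triple products. Each of the six orderings of
        \<open>x\<close>, \<open>y\<close>, \<open>z\<close> occurs once with each sign, so after
        clearing the difference both sides are the same sum up to order.\<close>
      by (simp add: mult_minus_left mult_minus_right mult_assoc M.diff_simps M.diff_eq_iff)
         (simp add: M.a_ac)
  qed
qed

end

section \<open>Composition in a categorical associative algebra\<close>

context categorical_assoc_algebra
begin

sublocale C1: assoc_algebra K C1 by (rule C1_assoc)
sublocale C0: assoc_algebra K C0 by (rule C0_assoc)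

lemmas s_linear = algebra_homD(1)[OF s_hom]
lemmas t_linear = algebra_homD(1)[OF t_hom]
lemmas e_linear = algebra_homD(1)[OF e_hom]

lemmas s_closed [simp, intro] = linear_mapD(1)[OF s_linear]
lemmas t_closed [simp, intro] = linear_mapD(1)[OF t_linear]
lemmas e_closed [simp, intro] = linear_mapD(1)[OF e_linear]

lemmas s_minus =
  linear_map_minus[OF C1.M.abelian_group_axioms C0.M.abelian_group_axioms s_linear]
lemmas t_minus =
  linear_map_minus[OF C1.M.abelian_group_axioms C0.M.abelian_group_axioms t_linear]

lemmas s_mult = algebra_homD(2)[OF s_hom]
lemmas t_mult = algebra_homD(2)[OF t_hom]

lemma comp_closed [simp, intro]:
  "\<lbrakk>x \<in> carrier C1; y \<in> carrier C1; t x = s y\<rbrakk> \<Longrightarrow> y \<cdot> x \<in> carrier C1"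
  using linear_mapD(1)[OF algebra_homD(1)[OF k_hom], of "(x, y)"]
  by (simp add: composable_pairs_def)

text \<open>This and \<open>comp_mult\<close> are interchange laws: \<open>k\<close> is a
  homomorphism and the operations on composable pairs are componentwise.\<close>

lemma comp_add:
  assumes "x \<in> carrier C1" "y \<in> carrier C1" "t x = s y"
    and "x' \<in> carrier C1" "y' \<in> carrier C1" "t x' = s y'"
  shows "(y \<oplus>\<^bsub>C1\<^esub> y') \<cdot> (x \<oplus>\<^bsub>C1\<^esub> x') = (y \<cdot> x) \<oplus>\<^bsub>C1\<^esub> (y' \<cdot> x')"
  using linear_mapD(2)[OF algebra_homD(1)[OF k_hom], of "(x, y)" "(x', y')"] assms
  by (simp add: composable_pairs_def)

lemma comp_mult:
  assumes "x \<in> carrier C1" "y \<in> carrier C1" "t x = s y"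
    and "x' \<in> carrier C1" "y' \<in> carrier C1" "t x' = s y'"
  shows "(y \<otimes>\<^bsub>C1\<^esub> y') \<cdot> (x \<otimes>\<^bsub>C1\<^esub> x') = (y \<cdot> x) \<otimes>\<^bsub>C1\<^esub> (y' \<cdot> x')"
  using algebra_homD(2)[OF k_hom, of "(x, y)" "(x', y')"] assms
  by (simp add: composable_pairs_def)

text \<open>Follows from \<open>comp_add\<close> for the difference pair and
  \<open>(x', y')\<close>; the difference pair is composable because \<open>s\<close> and
  \<open>t\<close> respect subtraction.\<close>

lemma comp_minus:
  assumes "x \<in> carrier C1" "y \<in> carrier C1" "t x = s y"
    and "x' \<in> carrier C1" "y' \<in> carrier C1" "t x' = s y'"
  shows "(y \<ominus>\<^bsub>C1\<^esub> y') \<cdot> (x \<ominus>\<^bsub>C1\<^esub> x') = (y \<cdot> x) \<ominus>\<^bsub>C1\<^esub> (y' \<cdot> x')"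
  using assms
  by (intro C1.M.eq_minus_if_add_eq)
     (simp_all add: s_minus t_minus C1.M.minus_add_cancel flip: comp_add)

text \<open>An argument of Eckmann-Hilton type: the identity at the middle object is added to both
  factors, and the interchange law is applied to two different splittings of the result.\<close>

lemma comp_eq:
  assumes "x \<in> carrier C1" "y \<in> carrier C1" "t x = s y"
  shows "y \<cdot> x = x \<oplus>\<^bsub>C1\<^esub> y \<ominus>\<^bsub>C1\<^esub> e (t x)"
proof (rule C1.M.eq_minus_if_add_eq)
  have e: "e (t x) \<cdot> e (t x) = e (t x)"
    using assms k_unit_source[of "e (t x)"] by (simp add: s_e)
  have "(y \<cdot> x) \<oplus>\<^bsub>C1\<^esub> (e (t x) \<cdot> e (t x)) = (y \<oplus>\<^bsub>C1\<^esub> e (t x)) \<cdot> (x \<oplus>\<^bsub>C1\<^esub> e (t x))"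
    using assms by (subst comp_add) (simp_all add: s_e t_e)
  \<comment> \<open>Swapping the summands on the left pairs \<open>x\<close> with the identity at
    its target and \<open>y\<close> with the identity at its source, so both composites collapse by
    the unit laws.\<close>
  also have "\<dots> = (e (t x) \<oplus>\<^bsub>C1\<^esub> y) \<cdot> (x \<oplus>\<^bsub>C1\<^esub> e (t x))"
    using assms by (simp add: C1.M.a_comm)
  also have "\<dots> = (e (t x) \<cdot> x) \<oplus>\<^bsub>C1\<^esub> (y \<cdot> e (s y))"
    using assms by (subst comp_add) (simp_all add: s_e t_e)
  also have "\<dots> = x \<oplus>\<^bsub>C1\<^esub> y"
    using assms k_unit_target[of x] k_unit_source[of y] by simp
  finally show "(y \<cdot> x) \<oplus>\<^bsub>C1\<^esub> e (t x) = x \<oplus>\<^bsub>C1\<^esub> y"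
    by (simp only: e)
qed (use assms in auto)

lemma categorical_lie_algebra_lie_of:
  "categorical_lie_algebra K (lie_of C1) (lie_of C0) s t e k"
proof (intro categorical_lie_algebra.intro internal_category.intro
    categorical_lie_algebra_axioms.intro)
  show "s \<in> algebra_hom K (lie_of C1) (lie_of C0)" "t \<in> algebra_hom K (lie_of C1) (lie_of C0)"
    "e \<in> algebra_hom K (lie_of C0) (lie_of C1)"
    using s_hom t_hom e_hom C0_assoc C1_assoc by (simp_all add: algebra_hom_lie_of)
  \<comment> \<open>Linearity carries over unchanged. For the bracket, \<open>s_mult\<close> and
    \<open>t_mult\<close> make the products in both orders composable, so \<open>comp_minus\<close>
    splits the composite and \<open>comp_mult\<close> treats each part.\<close>
  show "k \<in> algebra_hom K (composable_pairs (lie_of C1) s t) (lie_of C1)"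
    using algebra_homD(1)[OF k_hom]
    by (auto simp: algebra_hom_def linear_map_def composable_pairs_def comp_minus comp_mult
        s_mult t_mult)
  show "lie_algebra K (lie_of C1)" "lie_algebra K (lie_of C0)"
    by (rule C1.lie_algebra_lie_of C0.lie_algebra_lie_of)+
qed (simp_all add: s_e t_e s_k t_k k_unit_source k_unit_target k_assoc)

end

section \<open>The braiding and its antisymmetrization\<close>

context braided_categorical_assoc_algebra
begin

lemma \<tau>_closed [simp, intro]: "\<lbrakk>a \<in> carrier C0; b \<in> carrier C0\<rbrakk> \<Longrightarrow> \<tau> a b \<in> carrier C1"
  by (rule linear_mapD[OF bilinear_mapD(1)[OF \<tau>_bilinear]])

lemmas \<tau>_minus_right = linear_map_minus[OF C0.M.abelian_group_axioms C1.M.abelian_group_axioms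
    bilinear_mapD(1)[OF \<tau>_bilinear]]
lemmas \<tau>_minus_left = linear_map_minus[OF C0.M.abelian_group_axioms C1.M.abelian_group_axioms
    bilinear_mapD(2)[OF \<tau>_bilinear]]

text \<open>The subtracted identity sits at the middle object of the hexagon composite. Its product
  is nested to the right, here and in \<open>\<tau>_mult_right_eq\<close>, so that the identities
  from the two hexagons match literally.\<close>

lemma \<tau>_mult_left_eq:
  assumes "a \<in> carrier C0" "b \<in> carrier C0" "c \<in> carrier C0"
  shows "\<tau> (a \<otimes>\<^bsub>C0\<^esub> b) c =
    e a \<otimes>\<^bsub>C1\<^esub> \<tau> b c \<oplus>\<^bsub>C1\<^esub> \<tau> a c \<otimes>\<^bsub>C1\<^esub> e b \<ominus>\<^bsub>C1\<^esub> e (a \<otimes>\<^bsub>C0\<^esub> (c \<otimes>\<^bsub>C0\<^esub> b))"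
  using assms
  by (simp add: \<tau>_mult_left comp_eq s_mult t_mult s_\<tau> t_\<tau> s_e t_e C0.mult_assoc)

lemma \<tau>_mult_right_eq:
  assumes "a \<in> carrier C0" "b \<in> carrier C0" "c \<in> carrier C0"
  shows "\<tau> a (b \<otimes>\<^bsub>C0\<^esub> c) =
    \<tau> a b \<otimes>\<^bsub>C1\<^esub> e c \<oplus>\<^bsub>C1\<^esub> e b \<otimes>\<^bsub>C1\<^esub> \<tau> a c \<ominus>\<^bsub>C1\<^esub> e (b \<otimes>\<^bsub>C0\<^esub> (a \<otimes>\<^bsub>C0\<^esub> c))"
  using assms
  by (simp add: \<tau>_mult_right comp_eq s_mult t_mult s_\<tau> t_\<tau> s_e t_e C0.mult_assoc)

lemma braided_categorical_lie_algebra_lie_of: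
  "braided_categorical_lie_algebra K (lie_of C1) (lie_of C0) s t e k (lie_braiding C1 \<tau>)"
proof -
  interpret L: categorical_lie_algebra K "lie_of C1" "lie_of C0" s t e k
    by (rule categorical_lie_algebra_lie_of)
  show ?thesis
  proof
    have "lie_braiding C1 \<tau> = (\<lambda>a b. \<tau> a b \<ominus>\<^bsub>C1\<^esub> \<tau> b a)"
      by (simp add: lie_braiding_def fun_eq_iff)
    then show "lie_braiding C1 \<tau> \<in> bilinear_map K (lie_of C0) (lie_of C0) (lie_of C1)"
      using bilinear_map_antisymmetrize[OF C1.module_axioms \<tau>_bilinear] by simp
  next
    fix a b assume "a \<in> carrier (lie_of C0)" "b \<in> carrier (lie_of C0)"
    then show "s (lie_braiding C1 \<tau> a b) = a \<otimes>\<^bsub>lie_of C0\<^esub> b"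
      "t (lie_braiding C1 \<tau> a b) = b \<otimes>\<^bsub>lie_of C0\<^esub> a"
      by (simp_all add: lie_braiding_def s_minus t_minus s_\<tau> t_\<tau>)
  next
    fix x y assume "x \<in> carrier (lie_of C1)" "y \<in> carrier (lie_of C1)"
    then show "k (x \<otimes>\<^bsub>lie_of C1\<^esub> y, lie_braiding C1 \<tau> (t x) (t y)) =
        k (lie_braiding C1 \<tau> (s x) (s y), y \<otimes>\<^bsub>lie_of C1\<^esub> x)"
      \<comment> \<open>By \<open>comp_minus\<close> each side is a difference of two composites;
        they agree termwise by naturality of \<open>\<tau>\<close> at \<open>(x, y)\<close> and at
        \<open>(y, x)\<close>.\<close>
      by (simp add: lie_braiding_def comp_minus s_mult t_mult s_\<tau> t_\<tau> \<tau>_natural)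
  next
    fix a b c assume "a \<in> carrier (lie_of C0)" "b \<in> carrier (lie_of C0)" "c \<in> carrier (lie_of C0)"
    then show "lie_braiding C1 \<tau> (a \<otimes>\<^bsub>lie_of C0\<^esub> b) c =
        lie_braiding C1 \<tau> a c \<otimes>\<^bsub>lie_of C1\<^esub> e b \<oplus>\<^bsub>lie_of C1\<^esub> e a \<otimes>\<^bsub>lie_of C1\<^esub> lie_braiding C1 \<tau> b c"
      "lie_braiding C1 \<tau> a (b \<otimes>\<^bsub>lie_of C0\<^esub> c) =
        e b \<otimes>\<^bsub>lie_of C1\<^esub> lie_braiding C1 \<tau> a c \<oplus>\<^bsub>lie_of C1\<^esub> lie_braiding C1 \<tau> a b \<otimes>\<^bsub>lie_of C1\<^esub> e c"
      \<comment> \<open>In the first equation \<open>\<tau> (ab) c\<close> and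
        \<open>\<tau> c (ab)\<close> have the same middle object \<open>acb\<close>, and
        \<open>\<tau> (ba) c\<close> and \<open>\<tau> c (ba)\<close> share \<open>bca\<close>. Each
        pair enters with opposite signs, so its identities cancel, and the eight remaining terms are
        those of the two brackets. In the second equation the middle objects are \<open>bac\<close>
        and \<open>cab\<close>.\<close>
      by (simp_all add: lie_braiding_def \<tau>_minus_left \<tau>_minus_right \<tau>_mult_left_eq \<tau>_mult_right_eq
          C1.mult_minus_left C1.mult_minus_right C1.M.diff_simps C1.M.diff_eq_iff)
         (simp_all add: C1.M.a_ac)
  qed
qed

end

theorem proposition4p3:
  fixes K :: "('k, 'm) ring_scheme"
    and C1 :: "('k, 'a, 'p) module_scheme"
    and C0 :: "('k, 'b, 'q) module_scheme"
    and s t :: "'a \<Rightarrow> 'b"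
    and e :: "'b \<Rightarrow> 'a"
    and k :: "'a \<times> 'a \<Rightarrow> 'a"
    and \<tau> :: "'b \<Rightarrow> 'b \<Rightarrow> 'a"
  assumes "field K"
    and "braided_categorical_assoc_algebra K C1 C0 s t e k \<tau>"
  shows "braided_categorical_lie_algebra K (lie_of C1) (lie_of C0) s t e k (lie_braiding C1 \<tau>)"
  using assms(2) by (rule braided_categorical_assoc_algebra.braided_categorical_lie_algebra_lie_of)

end
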